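(* Let $V\subset\mathbb{R}^n$ be a tropical prevariety with $\dim V=1$. Then the limit $$\deg T(V):=\lim_{k\to\infty}\frac{TH_V(k)}{k}$$ exists; that is, the tropical degree of $V$ is defined.
   Context: A tropical prevariety (equivalently, min-plus prevariety) $V\subset\mathbb{R}^n$ is the set of common solutions $x\in\mathbb{R}^n$ of finitely many equations $f_i(x)=g_i(x)$, where $f_i,g_i$ are tropical polynomials, i.e. functions of the form $\min_{1\le i\le s}\{a_{i,1}x_1+\cdots+a_{i,n}x_n+a_{i,0}\}$ with non-negative integers $a_{i,j}$ ($1\le j\le n$) and $a_{i,0}\in\mathbb{R}$. Equivalently, $V$ is a finite union of rational polyhedra (polyhedra given by finitely many linear inequalities whose coefficients at the variables are rational, the constant terms being real). $\dim V$ is the maximal dimension of these polyhedra. Tropical polynomials $f_1,\dots,f_m$ are tropically independent on $V$ if there exist $b_1,\dots,b_m\in\mathbb{R}$ and $v_1,\dots,v_m\in V$ such that $b_{j_0}+f_{j_0}(v_{j_0})<b_j+f_j(v_{j_0})$ for all $1\le j\ne j_0\le m$. The tropical Hilbert function $TH_V(k)$ is the maximal number of elements of a subset, tropically independent on $V$, of the set of tropical monomials $$M_k=\{i_1x_1+\cdots+i_nx_n \mid i_1,\dots,i_n\in\mathbb{Z}_{\ge 0},\ i_1+\cdots+i_n\le k\}.$$ *)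

theory Defs
  imports "HOL-Analysis.Analysis"
begin

definition tropical_monomial :: "('n::finite \<Rightarrow> nat) \<Rightarrow> real^'n \<Rightarrow> real" where
  "tropical_monomial a x = (\<Sum>j\<in>UNIV. real (a j) * x $ j)"

definition tropical_polynomial :: "(real^'n::finite \<Rightarrow> real) \<Rightarrow> bool" where
  "tropical_polynomial f \<longleftrightarrow>
     (\<exists>(s::nat) (a :: nat \<Rightarrow> 'n \<Rightarrow> nat) (c :: nat \<Rightarrow> real).
        s \<ge> 1 \<and> (\<forall>x. f x = Min ((\<lambda>i. tropical_monomial (a i) x + c i) ` {1..s})))"

definition tropical_prevariety :: "(real^'n::finite) set \<Rightarrow> bool" where
  "tropical_prevariety V \<longleftrightarrow>
     (\<exists>E. finite E \<and>
        (\<forall>(f, g)\<in>E. tropical_polynomial f \<and> tropical_polynomial g) \<and>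
        V = {x. \<forall>(f, g)\<in>E. f x = g x})"

definition rational_polyhedron :: "(real^'n::finite) set \<Rightarrow> bool" where
  "rational_polyhedron S \<longleftrightarrow>
     (\<exists>H :: ((real^'n) \<times> real) set. finite H \<and>
        (\<forall>(u, c)\<in>H. \<forall>j. u $ j \<in> \<rat>) \<and>
        S = {x. \<forall>(u, c)\<in>H. u \<bullet> x \<le> c})"

definition polyhedral_decomposition :: "(real^'n::finite) set \<Rightarrow> (real^'n) set set \<Rightarrow> bool" where
  "polyhedral_decomposition V P \<longleftrightarrow>
     finite P \<and> P \<noteq> {} \<and> (\<forall>S\<in>P. rational_polyhedron S) \<and> V = \<Union>P"

text \<open>The maximal dimension of the polyhedra in a decomposition of \<open>V\<close>. By
  \<open>polyhedral_decomposition_exists\<close> and \<open>polyhedral_decomposition_dim_unique\<close> below, every tropical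
  prevariety has such a decomposition and the number does not depend on its choice. The dimension
  of the empty set is \<open>-1\<close>.\<close>

definition prevariety_dim :: "(real^'n::finite) set \<Rightarrow> int" where
  "prevariety_dim V =
     (THE d. \<exists>P. polyhedral_decomposition V P \<and> d = Max (aff_dim ` P))"

text \<open>Independence of the family \<open>f\<^sub>1, \<dots>, f\<^sub>m\<close>, for a finite set of pairwise distinct functions; the
  set itself indexes the coefficients \<open>b\<close> and the points \<open>v\<close>.\<close>

definition tropically_independent ::
    "(real^'n::finite) set \<Rightarrow> (real^'n \<Rightarrow> real) set \<Rightarrow> bool" where
  "tropically_independent V F \<longleftrightarrow> finite F \<and>
     (\<exists>(b :: (real^'n \<Rightarrow> real) \<Rightarrow> real) (v :: (real^'n \<Rightarrow> real) \<Rightarrow> real^'n).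
        (\<forall>f\<in>F. v f \<in> V) \<and>
        (\<forall>f\<in>F. \<forall>g\<in>F. g \<noteq> f \<longrightarrow> b f + f (v f) < b g + g (v f)))"

definition tropical_monomials :: "nat \<Rightarrow> (real^'n::finite \<Rightarrow> real) set" where
  "tropical_monomials k = {tropical_monomial a | a. (\<Sum>j\<in>UNIV. a j) \<le> k}"

definition tropical_hilbert :: "(real^'n::finite) set \<Rightarrow> nat \<Rightarrow> nat" where
  "tropical_hilbert V k =
     Max {card F | F. F \<subseteq> tropical_monomials k \<and> tropically_independent V F}"

subsection \<open>The dimension is well defined\<close>

lemma rational_polyhedron_closed_convex:
  assumes "rational_polyhedron S"
  shows "closed S" "convex S"
proof -
  obtain H where H: "finite H" "S = {x. \<forall>(u, c)\<in>H. u \<bullet> x \<le> c}"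
    using assms unfolding rational_polyhedron_def by blast
  have eq: "S = (\<Inter>h\<in>H. {x. fst h \<bullet> x \<le> snd h})"
    unfolding H(2) by (auto simp: case_prod_beta)
  show "closed S" unfolding eq by (intro closed_INT ballI closed_halfspace_le)
  show "convex S" unfolding eq by (intro convex_INT convex_halfspace_le)
qed

lemma rational_polyhedron_Int:
  assumes "rational_polyhedron S" "rational_polyhedron T"
  shows "rational_polyhedron (S \<inter> T)"
proof -
  obtain H where H: "finite H" "\<forall>(u, c)\<in>H. \<forall>j. u $ j \<in> \<rat>" "S = {x. \<forall>(u, c)\<in>H. u \<bullet> x \<le> c}"
    using assms(1) unfolding rational_polyhedron_def by blast
  obtain K where K: "finite K" "\<forall>(u, c)\<in>K. \<forall>j. u $ j \<in> \<rat>" "T = {x. \<forall>(u, c)\<in>K. u \<bullet> x \<le> c}"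
    using assms(2) unfolding rational_polyhedron_def by blast
  show ?thesis unfolding rational_polyhedron_def
    by (rule exI[of _ "H \<union> K"]) (use H K in auto)
qed

lemma rational_polyhedron_UNIV: "rational_polyhedron UNIV"
  unfolding rational_polyhedron_def by (rule exI[of _ "{}"]) auto

lemma rational_polyhedron_INT:
  assumes "finite I" "\<And>i. i \<in> I \<Longrightarrow> rational_polyhedron (S i)"
  shows "rational_polyhedron (\<Inter>i\<in>I. S i)"
  using assms
  by (induction I rule: finite_induct)
     (auto intro: rational_polyhedron_Int rational_polyhedron_UNIV)

lemma rational_polyhedron_le:
  "rational_polyhedron {x. tropical_monomial a x + c \<le> tropical_monomial b x + d}"
proof -
  let ?u = "\<chi> j. real (a j) - real (b j)"
  have "tropical_monomial a x - tropical_monomial b x = ?u \<bullet> x" for x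
    by (simp add: tropical_monomial_def inner_vec_def sum_subtractf algebra_simps)
  then have "{x. tropical_monomial a x + c \<le> tropical_monomial b x + d} =
      {x. ?u \<bullet> x \<le> d - c}"
    by (auto simp: algebra_simps)
  then show ?thesis unfolding rational_polyhedron_def
    by (intro exI[of _ "{(?u, d - c)}"]) auto
qed

lemma equation_decomposition:
  assumes "tropical_polynomial f" "tropical_polynomial g"
  shows "\<exists>P. polyhedral_decomposition {x. f x = g x} P"
proof -
  obtain s a c where f: "s \<ge> (1::nat)"
      "\<And>x. f x = Min ((\<lambda>i. tropical_monomial (a i) x + c i) ` {1..s})"
    using assms(1) unfolding tropical_polynomial_def by blast
  obtain t b d where g: "t \<ge> (1::nat)"
      "\<And>x. g x = Min ((\<lambda>i. tropical_monomial (b i) x + d i) ` {1..t})"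
    using assms(2) unfolding tropical_polynomial_def by blast
  define l where "l i x = tropical_monomial (a i) x + c i" for i x
  define m where "m i x = tropical_monomial (b i) x + d i" for i x
  define Q where "Q p = (\<Inter>i\<in>{1..s}. {x. l (fst p) x \<le> l i x}) \<inter>
     (\<Inter>j\<in>{1..t}. {x. m (snd p) x \<le> m j x}) \<inter>
     ({x. l (fst p) x \<le> m (snd p) x} \<inter> {x. m (snd p) x \<le> l (fst p) x})" for p
  have Q: "rational_polyhedron (Q p)" for p
    unfolding Q_def l_def m_def
    by (intro rational_polyhedron_Int rational_polyhedron_INT rational_polyhedron_le) auto
  have fM: "f x = l i x" if "i \<in> {1..s}" "\<forall>i'\<in>{1..s}. l i x \<le> l i' x" for i x
    unfolding f(2) l_def[symmetric] by (rule Min_eqI) (use that in auto)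
  have gM: "g x = m i x" if "i \<in> {1..t}" "\<forall>i'\<in>{1..t}. m i x \<le> m i' x" for i x
    unfolding g(2) m_def[symmetric] by (rule Min_eqI) (use that in auto)
  have fE: "\<exists>i\<in>{1..s}. \<forall>i'\<in>{1..s}. l i x \<le> l i' x" for x
    using ex_is_arg_min_if_finite[of "{1..s}" "\<lambda>i. l i x"] f(1)
    by (force simp: is_arg_min_linorder)
  have gE: "\<exists>i\<in>{1..t}. \<forall>i'\<in>{1..t}. m i x \<le> m i' x" for x
    using ex_is_arg_min_if_finite[of "{1..t}" "\<lambda>i. m i x"] g(1)
    by (force simp: is_arg_min_linorder)
  have "{x. f x = g x} = \<Union>(Q ` ({1..s} \<times> {1..t}))"
  proof (intro set_eqI iffI)
    fix x assume "x \<in> {x. f x = g x}"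
    moreover obtain i where i: "i \<in> {1..s}" "\<forall>i'\<in>{1..s}. l i x \<le> l i' x" using fE by blast
    moreover obtain j where j: "j \<in> {1..t}" "\<forall>j'\<in>{1..t}. m j x \<le> m j' x" using gE by blast
    ultimately have "l i x = m j x" using fM[OF i] gM[OF j] by simp
    then have "x \<in> Q (i, j)" unfolding Q_def using i j by auto
    then show "x \<in> \<Union>(Q ` ({1..s} \<times> {1..t}))" using i(1) j(1) by blast
  next
    fix x assume "x \<in> \<Union>(Q ` ({1..s} \<times> {1..t}))"
    then obtain i j where ij: "i \<in> {1..s}" "j \<in> {1..t}" "x \<in> Q (i, j)" by auto
    then have "f x = l i x" "g x = m j x" "l i x = m j x"
      using fM[of i x] gM[of j x] unfolding Q_def by auto
    then show "x \<in> {x. f x = g x}" by simp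
  qed
  moreover have "Q ` ({1..s} \<times> {1..t}) \<noteq> {}" using f(1) g(1) by auto
  ultimately show ?thesis unfolding polyhedral_decomposition_def
    using Q by (intro exI[of _ "Q ` ({1..s} \<times> {1..t})"]) auto
qed

lemma polyhedral_decomposition_Int:
  assumes "polyhedral_decomposition V P" "polyhedral_decomposition W R"
  shows "polyhedral_decomposition (V \<inter> W) ((\<lambda>(S, T). S \<inter> T) ` (P \<times> R))"
  using assms unfolding polyhedral_decomposition_def
  by (fastforce intro: rational_polyhedron_Int)

lemma polyhedral_decomposition_exists:
  assumes "tropical_prevariety V"
  shows "\<exists>P. polyhedral_decomposition V P"
proof -
  obtain E where E: "finite E" "\<forall>(f, g)\<in>E. tropical_polynomial f \<and> tropical_polynomial g"
      "V = {x. \<forall>(f, g)\<in>E. f x = g x}"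
    using assms unfolding tropical_prevariety_def by blast
  have "\<exists>P. polyhedral_decomposition {x. \<forall>(f, g)\<in>E. f x = g x} P"
    using E(1,2)
  proof (induction E rule: finite_induct)
    case empty
    show ?case
      by (rule exI[of _ "{UNIV}"])
         (simp add: polyhedral_decomposition_def rational_polyhedron_UNIV)
  next
    case (insert e E)
    obtain f g where e: "e = (f, g)" by force
    obtain P where P: "polyhedral_decomposition {x. \<forall>(f, g)\<in>E. f x = g x} P"
      using insert by auto
    obtain R where R: "polyhedral_decomposition {x. f x = g x} R"
      using equation_decomposition[of f g] insert.prems e by auto
    have "{x. \<forall>(f, g)\<in>insert e E. f x = g x} = {x. f x = g x} \<inter> {x. \<forall>(f, g)\<in>E. f x = g x}"
      using e by auto
    then show ?case using polyhedral_decomposition_Int[OF R P] by metis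
  qed
  then show ?thesis using E(3) by simp
qed

lemma openin_subset_finite_Union_closed:
  fixes U :: "'a::euclidean_space set"
  assumes "finite P" "\<And>S. S \<in> P \<Longrightarrow> closed S" "affine A"
    "openin (top_of_set A) U" "U \<noteq> {}" "U \<subseteq> \<Union>P"
  shows "\<exists>S\<in>P. aff_dim A \<le> aff_dim S"
  using assms
proof (induction P arbitrary: U rule: finite_induct)
  case empty
  then show ?case by auto
next
  case (insert S P)
  show ?case
  proof (cases "U \<subseteq> S")
    case True
    then have "aff_dim A \<le> aff_dim S"
      using aff_dim_openin[OF insert.prems(3,2,4)] aff_dim_subset[OF True] by simp
    then show ?thesis by blast
  next
    case False
    have "openin (top_of_set A) (U - S)"
      using insert.prems(1,3) by (metis Diff_eq closed_def insertI1 openin_Int_open)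
    then show ?thesis using insert.IH[of "U - S"] insert.prems False by blast
  qed
qed

lemma polyhedral_decomposition_dim_unique:
  assumes "polyhedral_decomposition V P" "polyhedral_decomposition V R"
  shows "Max (aff_dim ` P) = Max (aff_dim ` R)"
proof -
  have *: "Max (aff_dim ` P) \<le> Max (aff_dim ` R)"
    if P: "polyhedral_decomposition V P" and R: "polyhedral_decomposition V R" for P R
  proof -
    have fin: "finite P" "P \<noteq> {}" "finite R" "R \<noteq> {}"
      using P R unfolding polyhedral_decomposition_def by auto
    have "aff_dim S \<le> Max (aff_dim ` R)" if S: "S \<in> P" for S
    proof -
      have "\<exists>T\<in>R. aff_dim S \<le> aff_dim T"
      proof (cases "S = {}")
        case True
        then show ?thesis using fin(4) aff_dim_geq by (auto simp: aff_dim_empty[symmetric])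
      next
        case False
        have conv: "convex S"
          using P S rational_polyhedron_closed_convex unfolding polyhedral_decomposition_def by blast
        have "S \<subseteq> \<Union>R" using P R S unfolding polyhedral_decomposition_def by blast
        then have "rel_interior S \<subseteq> \<Union>R" using rel_interior_subset by blast
        moreover have "rel_interior S \<noteq> {}" using conv False rel_interior_eq_empty by blast
        moreover have "closed T" if "T \<in> R" for T
          using R that rational_polyhedron_closed_convex
          unfolding polyhedral_decomposition_def by blast
        ultimately have "\<exists>T\<in>R. aff_dim (affine hull S) \<le> aff_dim T"
          using openin_subset_finite_Union_closed[OF fin(3) _ affine_affine_hull
              openin_rel_interior] by blast
        then show ?thesis by simp
      qed
      then show ?thesis using fin(3) by (meson Max_ge finite_imageI imageI order_trans)
    qed
    then show ?thesis using fin by auto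
  qed
  show ?thesis using *[OF assms] *[OF assms(2,1)] by simp
qed

lemma prevariety_dim_eq:
  assumes "polyhedral_decomposition V P"
  shows "prevariety_dim V = Max (aff_dim ` P)"
  unfolding prevariety_dim_def
  using assms polyhedral_decomposition_dim_unique by (intro the_equality) blast+

subsection \<open>The maximum defining the tropical Hilbert function is attained\<close>

lemma finite_tropical_monomials: "finite (tropical_monomials k)"
proof -
  have "tropical_monomials k \<subseteq> tropical_monomial ` (PiE UNIV (\<lambda>_. {..k}))"
  proof
    fix f assume "f \<in> tropical_monomials k"
    then obtain a where a: "f = tropical_monomial a" "(\<Sum>j\<in>UNIV. a j) \<le> k"
      unfolding tropical_monomials_def by blast
    have "a j \<le> k" for j
      using member_le_sum[of j UNIV a] a(2) by simp
    then show "f \<in> tropical_monomial ` (PiE UNIV (\<lambda>_. {..k}))" using a(1) by auto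
  qed
  then show ?thesis by (rule finite_subset) (intro finite_imageI finite_PiE, auto)
qed

lemma tropical_hilbert_attained:
  fixes V :: "(real^'n::finite) set"
  shows "\<exists>F \<subseteq> tropical_monomials k. tropically_independent V F \<and> card F = tropical_hilbert V k"
    and "\<And>F. F \<subseteq> tropical_monomials k \<Longrightarrow> tropically_independent V F \<Longrightarrow> card F \<le> tropical_hilbert V k"
proof -
  let ?C = "{card F | F. F \<subseteq> tropical_monomials k \<and> tropically_independent V F}"
  have "?C \<subseteq> card ` Pow (tropical_monomials k :: (real^'n \<Rightarrow> real) set)" by blast
  then have fin: "finite ?C"
    by (rule finite_subset) (intro finite_imageI, simp add: finite_tropical_monomials)
  have "tropically_independent V {}" unfolding tropically_independent_def by simp
  then have "card ({} :: (real^'n \<Rightarrow> real) set) \<in> ?C" by blast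
  then have "tropical_hilbert V k \<in> ?C"
    unfolding tropical_hilbert_def using Max_in[OF fin] by blast
  then show "\<exists>F \<subseteq> tropical_monomials k. tropically_independent V F \<and> card F = tropical_hilbert V k"
    by (clarsimp) metis
  show "card F \<le> tropical_hilbert V k"
    if "F \<subseteq> tropical_monomials k" "tropically_independent V F" for F
    unfolding tropical_hilbert_def using that by (intro Max_ge[OF fin]) blast
qed

end

theory Submission
  imports Defs
begin

text \<open>
  The function \<open>TH(k) = tropical_hilbert V k\<close> is superadditive up to a constant and grows at most linearly, so
  \<open>TH(k)/k\<close> converges by Fekete's lemma (\<open>superadditive_convergent\<close>). Fix a decomposition of \<open>V\<close> into a
  finite set \<open>P\<close> of rational polyhedra; dimension \<open>1\<close> means that each of them lies on a line.

  Superadditivity, \<open>TH(k) + TH(l) \<le> TH(k+l) + card P\<close> (\<open>tropical_hilbert_superadditive\<close>): independent families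
  \<open>F\<close> and \<open>G\<close> of monomials are the sets of monomials of two tropical polynomials, each of which is the unique
  minimizer somewhere on \<open>V\<close>. In the tropical product of the polynomials, the sums \<open>f + g\<close> such that \<open>f\<close> and \<open>g\<close>
  are unique minimizers at a common point of \<open>V\<close> are pairwise distinct and again independent
  (\<open>independent_products\<close>). To count these pairs, regard them as the edges of a bipartite graph with vertex
  set \<open>F\<close> and \<open>G\<close>. After a small perturbation of the coefficients each polynomial has a unique
  minimizing monomial on \<open>V\<close> outside a finite set, and the two finite sets are disjoint (\<open>generic_coefficients\<close>). Moving along one polyhedron, only one
  member of the pair changes at a time, so each polyhedron carries a connected part of the graph
  (\<open>linked_overlaps\<close>). A graph without isolated vertices that is a union of \<open>card P\<close> connected parts has at
  least \<open>card F + card G - card P\<close> edges (\<open>card_union_of_linked\<close>).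

  Linear growth (\<open>tropical_hilbert_linear_bound\<close>) is where rationality enters: the line through a
  one-dimensional rational polyhedron has an integer direction
  (\<open>rational_polyhedron_integer_direction\<close>), so monomials of degree at most \<open>k\<close> have only \<open>O(k)\<close> slopes on it,
  and members of an independent family that are minimal on the same line have distinct slopes
  (\<open>card_independent_on_line\<close>).
\<close>

section \<open>Rational polyhedra of dimension one\<close>

text \<open>Extending \<open>1 \<mapsto> 1\<close> along a Hamel basis of \<open>\<real>\<close> over \<open>\<rat>\<close>. Applied to each coordinate of a real
  solution of a rational homogeneous linear system, such a functional gives a rational solution; this
  replaces Gaussian elimination over \<open>\<rat>\<close>.\<close>

lemma rational_linear_functional:
  obtains \<phi> :: "real \<Rightarrow> real" where
    "\<And>x. \<phi> x \<in> \<rat>" "\<And>x y. \<phi> (x + y) = \<phi> x + \<phi> y"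
    "\<And>q x. q \<in> \<rat> \<Longrightarrow> \<phi> (q * x) = q * \<phi> x" "\<phi> 1 = 1"
proof -
  interpret vector_space_pair "\<lambda>(q::rat) (x::real). of_rat q * x" "(*) :: rat \<Rightarrow> rat \<Rightarrow> rat"
    by unfold_locales (simp_all add: of_rat_add of_rat_mult algebra_simps)
  have "vs1.independent {1 :: real}"
    by simp
  then obtain g :: "real \<Rightarrow> rat"
    where g: "Vector_Spaces.linear (\<lambda>q x. of_rat q * x) (*) g" "g 1 = 1"
    using linear_independent_extend[of "{1}" "\<lambda>_. 1"] by auto
  interpret g: Vector_Spaces.linear "\<lambda>(q::rat) (x::real). of_rat q * x" "(*)" g
    by (rule g(1))
  show thesis
  proof (rule that[of "\<lambda>x. of_rat (g x)"])
    show "of_rat (g (q * x)) = q * (of_rat (g x) :: real)" if "q \<in> \<rat>" for q x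
      using that by (auto elim!: Rats_cases simp: g.scale of_rat_mult)
  qed (simp_all add: g.add of_rat_add g(2))
qed

lemma common_denominator:
  fixes q :: "real^'n::finite"
  assumes "\<And>j. q $ j \<in> \<rat>"
  obtains N :: nat where "N > 0" "\<And>j. real N * q $ j \<in> \<int>"
proof -
  have "\<exists>n::nat. n > 0 \<and> real n * q $ j \<in> \<int>" for j
  proof -
    obtain a b :: int where "b > 0" "q $ j = of_int a / of_int b"
      using assms[of j] by (metis Rats_cases')
    then show ?thesis by (intro exI[of _ "nat b"]) auto
  qed
  then obtain n where n: "\<And>j. n j > (0::nat)" "\<And>j. real (n j) * q $ j \<in> \<int>" by metis
  show thesis
  proof (rule that[of "\<Prod>j\<in>UNIV. n j"])
    show "(\<Prod>j\<in>UNIV. n j) > 0" using n(1) by (simp add: prod_pos)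
    fix j
    have "real (\<Prod>j\<in>UNIV. n j) * q $ j = real (\<Prod>i\<in>UNIV-{j}. n i) * (real (n j) * q $ j)"
      by (subst prod.remove[of UNIV j]) auto
    then show "real (\<Prod>j\<in>UNIV. n j) * q $ j \<in> \<int>" using n(2)[of j]
      by (metis Ints_mult Ints_of_nat)
  qed
qed

lemma eventually_affine_nonzero:
  fixes c \<kappa> :: real
  assumes "c \<noteq> 0"
  shows "\<forall>\<^sub>F \<epsilon> in at_right 0. \<kappa> + \<epsilon> * c \<noteq> 0"
  using eventually_neq_at_within[of "- \<kappa> / c" 0 "{0<..}"]
  by eventually_elim (use assms in \<open>auto simp: field_simps\<close>)

lemma eventually_perturbed_less:
  fixes a b c d :: real
  assumes "a < b"
  shows "\<forall>\<^sub>F \<epsilon> in at_right 0. a + \<epsilon> * c < b + \<epsilon> * d"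
proof -
  have "((\<lambda>\<epsilon>. (b - a) + \<epsilon> * (d - c)) \<longlongrightarrow> b - a) (at_right 0)"
    by (auto intro!: tendsto_eq_intros)
  then have "\<forall>\<^sub>F \<epsilon> in at_right 0. 0 < (b - a) + \<epsilon> * (d - c)"
    by (rule order_tendstoD(1)) (use assms in simp)
  then show ?thesis by eventually_elim (simp add: algebra_simps)
qed

text \<open>Scale the difference \<open>e\<close> of two points of \<open>S\<close> so that one coordinate is \<open>1\<close>, and apply a
  \<open>\<rat>\<close>-linear retraction \<open>\<real> \<rightarrow> \<rat>\<close> to every coordinate. The resulting rational vector \<open>q\<close> is not zero and is
  still orthogonal to every rational \<open>w\<close> orthogonal to \<open>e\<close>. The constraints of \<open>S\<close> whose normal is not
  orthogonal to \<open>e\<close> are strict at the midpoint of the two points, so a small step from the midpoint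
  along \<open>q\<close> stays inside \<open>S\<close>. As \<open>S\<close> is collinear, \<open>q\<close> is parallel to it; clearing denominators gives
  an integer direction. A polyhedron with at most one point is covered by \<open>d = 0\<close>.\<close>

lemma rational_polyhedron_integer_direction:
  fixes S :: "(real^'n::finite) set"
  assumes "rational_polyhedron S" and "aff_dim S \<le> 1"
  obtains d :: "real^'n" where "\<And>j. d $ j \<in> \<int>" "\<And>x y. x \<in> S \<Longrightarrow> y \<in> S \<Longrightarrow> \<exists>c. x - y = c *\<^sub>R d"
proof (cases "\<exists>x\<in>S. \<exists>y\<in>S. x \<noteq> y")
  case False
  then show thesis by (intro that[of 0]) auto
next
  case True
  then obtain x y where xy: "x \<in> S" "y \<in> S" "x \<noteq> y" by blast
  obtain u where u: "\<And>x y. x \<in> S \<Longrightarrow> y \<in> S \<Longrightarrow> \<exists>c. x - y = c *\<^sub>R u"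
    using assms(2) unfolding collinear_aff_dim[symmetric] collinear_def by blast
  obtain H where H0: "finite H \<and> (\<forall>(w, c)\<in>H. \<forall>j. w $ j \<in> \<rat>) \<and>
      S = {x. \<forall>(w, c)\<in>H. w \<bullet> x \<le> c}"
    using assms(1) unfolding rational_polyhedron_def ..
  then have H: "finite H" "\<And>w c j. (w, c) \<in> H \<Longrightarrow> w $ j \<in> \<rat>"
      "S = {x. \<forall>(w, c)\<in>H. w \<bullet> x \<le> c}"
    by auto
  obtain \<phi> :: "real \<Rightarrow> real" where \<phi>: "\<And>x. \<phi> x \<in> \<rat>" "\<And>x y. \<phi> (x + y) = \<phi> x + \<phi> y"
    "\<And>q x. q \<in> \<rat> \<Longrightarrow> \<phi> (q * x) = q * \<phi> x" "\<phi> 1 = 1"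
    by (rule rational_linear_functional, rule that)
  have \<phi>0: "\<phi> 0 = 0" using \<phi>(2)[of 0 0] by simp
  have \<phi>_sum: "\<phi> (sum f A) = (\<Sum>a\<in>A. \<phi> (f a))" if "finite A" for f and A :: "'n set"
    using that by (induction A rule: finite_induct) (simp_all add: \<phi>0 \<phi>(2))
  define e where "e = x - y"
  obtain i where i: "e $ i \<noteq> 0" using xy(3) by (auto simp: e_def vec_eq_iff)
  define q :: "real^'n" where "q = (\<chi> j. \<phi> (e $ j / e $ i))"
  have q_i: "q $ i = 1" using i by (simp add: q_def \<phi>(4))
  \<comment> \<open>At the midpoint, a constraint is strict unless its normal is orthogonal to \<open>e\<close>.\<close>
  define m where "m = (1/2) *\<^sub>R (x + y)"
  have mx: "w \<bullet> m = w \<bullet> x - (w \<bullet> e) / 2" and my: "w \<bullet> m = w \<bullet> y + (w \<bullet> e) / 2" for w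
    by (simp_all add: m_def e_def inner_add_right inner_diff_right field_simps)
  have "\<forall>\<^sub>F \<epsilon> in at_right 0. w \<bullet> m + \<epsilon> * (w \<bullet> q) \<le> c" if wc: "(w, c) \<in> H" for w c
  proof -
    have le: "w \<bullet> x \<le> c" "w \<bullet> y \<le> c" using xy wc H(3) by auto
    show ?thesis
    proof (cases "w \<bullet> e = 0")
      case True
      have "w \<bullet> q = (\<Sum>j\<in>UNIV. \<phi> (w $ j * (e $ j / e $ i)))"
        by (simp only: inner_vec_def q_def vec_lambda_beta inner_real_def \<phi>(3)[OF H(2)[OF wc]])
      also have "\<dots> = \<phi> ((\<Sum>j\<in>UNIV. w $ j * e $ j) / e $ i)"
        by (simp add: \<phi>_sum[symmetric] sum_divide_distrib)
      also have "\<dots> = 0" using True by (simp add: inner_vec_def \<phi>0)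
      finally show ?thesis using le mx[of w] True by simp
    next
      case False
      have "w \<bullet> m < c" using le mx[of w] my[of w] False by linarith
      from eventually_perturbed_less[OF this, of "w \<bullet> q" 0] show ?thesis
        by eventually_elim simp
    qed
  qed
  then have "\<forall>\<^sub>F \<epsilon> in at_right 0. \<forall>h\<in>H. fst h \<bullet> m + \<epsilon> * (fst h \<bullet> q) \<le> snd h"
    using H(1) by (intro eventually_ball_finite) auto
  moreover have "\<forall>\<^sub>F \<epsilon> in at_right 0. \<epsilon> > (0::real)"
    by (simp add: eventually_at_right_less)
  ultimately have "\<forall>\<^sub>F \<epsilon> in at_right 0. \<epsilon> > 0 \<and> m + \<epsilon> *\<^sub>R q \<in> S"
    by eventually_elim (auto simp: H(3) inner_add_right)
  from eventually_happens'[OF trivial_limit_at_right_real this]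
  obtain \<epsilon> where \<epsilon>: "\<epsilon> > 0" "m + \<epsilon> *\<^sub>R q \<in> S" by blast
  have "convex S" using rational_polyhedron_closed_convex(2)[OF assms(1)] .
  then have "m \<in> S" using xy convexD[of S x y "1/2" "1/2"] by (simp add: m_def scaleR_add_right)
  then obtain t where "\<epsilon> *\<^sub>R q = t *\<^sub>R u" using u[OF \<epsilon>(2), of m] by auto
  then have "(1 / \<epsilon>) *\<^sub>R (\<epsilon> *\<^sub>R q) = (t / \<epsilon>) *\<^sub>R u" by simp
  then have qu: "q = (t / \<epsilon>) *\<^sub>R u" using \<epsilon>(1) by simp
  have "t \<noteq> 0"
    using qu q_i by (metis div_0 scaleR_zero_left zero_index zero_neq_one)
  with qu \<epsilon>(1) have uq: "u = (\<epsilon> / t) *\<^sub>R q" by simp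
  have "q $ j \<in> \<rat>" for j by (simp add: q_def \<phi>(1))
  then obtain N :: nat where N: "N > 0" "\<And>j. real N * q $ j \<in> \<int>"
    by (rule common_denominator) blast
  show thesis
  proof (rule that[of "real N *\<^sub>R q"])
    show "(real N *\<^sub>R q) $ j \<in> \<int>" for j using N(2) by simp
    fix x y assume "x \<in> S" "y \<in> S"
    then obtain c where "x - y = c *\<^sub>R u" using u by blast
    also have "\<dots> = (c * \<epsilon> / (t * N)) *\<^sub>R (real N *\<^sub>R q)" using N(1) by (simp add: uq)
    finally show "\<exists>c. x - y = c *\<^sub>R (real N *\<^sub>R q)" by blast
  qed
qed

section \<open>Linear growth of the tropical Hilbert function\<close>

lemma tropical_monomial_linear: "linear (tropical_monomial a)"
  by (rule linearI)
     (simp_all add: tropical_monomial_def algebra_simps sum.distrib sum_distrib_left)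

lemma tropical_monomials_linear: "f \<in> tropical_monomials k \<Longrightarrow> linear f"
  by (auto simp: tropical_monomials_def tropical_monomial_linear)

lemma tropical_monomials_add:
  assumes "f \<in> tropical_monomials k" "g \<in> tropical_monomials l"
  shows "(\<lambda>x. f x + g x) \<in> tropical_monomials (k + l)"
proof -
  obtain a b where a: "f = tropical_monomial a" "sum a UNIV \<le> k"
    and b: "g = tropical_monomial b" "sum b UNIV \<le> l"
    using assms unfolding tropical_monomials_def by blast
  have "(\<lambda>x. f x + g x) = tropical_monomial (\<lambda>j. a j + b j)"
    by (simp add: fun_eq_iff a b tropical_monomial_def sum.distrib algebra_simps)
  moreover have "(\<Sum>j\<in>UNIV. a j + b j) \<le> k + l" using a b by (simp add: sum.distrib)
  ultimately show ?thesis unfolding tropical_monomials_def by blast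
qed

lemma tropical_monomial_integer_bound:
  fixes d :: "real^'n::finite"
  assumes "\<And>j. d $ j \<in> \<int>" and "(\<Sum>j\<in>UNIV. \<bar>d $ j\<bar>) \<le> real D"
    and "f \<in> tropical_monomials k"
  shows "f d \<in> real_of_int ` {- int (k * D)..int (k * D)}"
proof -
  obtain a where a: "f = tropical_monomial a" "sum a UNIV \<le> k"
    using assms(3) unfolding tropical_monomials_def by blast
  have ak: "real (a j) \<le> real k" for j
    using member_le_sum[of j UNIV a] a(2) by simp
  have "f d \<in> \<int>" unfolding a(1) tropical_monomial_def using assms(1)
    by (intro Ints_sum Ints_mult) auto
  then obtain z where z: "f d = of_int z" by (auto elim: Ints_cases)
  have "\<bar>f d\<bar> \<le> (\<Sum>j\<in>UNIV. \<bar>real (a j) * d $ j\<bar>)"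
    unfolding a(1) tropical_monomial_def by (rule sum_abs)
  also have "\<dots> \<le> (\<Sum>j\<in>UNIV. real k * \<bar>d $ j\<bar>)"
    using ak by (intro sum_mono) (simp add: abs_mult mult_right_mono)
  also have "\<dots> \<le> real (k * D)"
    using assms(2) by (simp add: sum_distrib_left[symmetric] mult_left_mono)
  finally have "\<bar>z\<bar> \<le> int (k * D)" unfolding z by linarith
  then have "z \<in> {- int (k * D)..int (k * D)}" by auto
  then show ?thesis unfolding z by (rule imageI)
qed

text \<open>The set where \<open>f\<close> is the only minimizer, among the members of \<open>F\<close>, of \<open>b g + g x\<close>: the open cell
  dual to the monomial \<open>f\<close> of the tropical polynomial with coefficients \<open>b\<close>. A finite family is tropically
  independent on \<open>V\<close> if and only if, for some \<open>b\<close>, all its strict regions meet \<open>V\<close>.\<close>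

definition strict_region ::
    "(('a \<Rightarrow> real) \<Rightarrow> real) \<Rightarrow> ('a \<Rightarrow> real) set \<Rightarrow> ('a \<Rightarrow> real) \<Rightarrow> 'a set" where
  "strict_region b F f = {x. \<forall>g\<in>F. g \<noteq> f \<longrightarrow> b f + f x < b g + g x}"

lemma strict_region_less:
  "x \<in> strict_region b F f \<Longrightarrow> g \<in> F \<Longrightarrow> g \<noteq> f \<Longrightarrow> b f + f x < b g + g x"
  by (simp add: strict_region_def)

lemma tropically_independentE:
  fixes V :: "(real^'n::finite) set"
  assumes "tropically_independent V F"
  obtains b v where "finite F" "\<And>f. f \<in> F \<Longrightarrow> v f \<in> V"
    "\<And>f. f \<in> F \<Longrightarrow> v f \<in> strict_region b F f"
proof -
  obtain b v where "(\<forall>f\<in>F. v f \<in> V) \<and>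
      (\<forall>f\<in>F. \<forall>g\<in>F. g \<noteq> f \<longrightarrow> b f + f (v f) < b g + g (v f))"
    using assms unfolding tropically_independent_def by (elim conjE exE) (rule that, rule conjI)
  then show thesis
    using assms unfolding tropically_independent_def
    by (intro that[of v b]) (simp_all add: strict_region_def)
qed

text \<open>On a line with direction \<open>d\<close>, two linear forms with the same slope \<open>f d = g d\<close> differ by a constant, so
  they cannot each be strictly minimal at some point of the line. An independent family is thus no larger
  than the set of possible slopes; these are integers in an interval whose length grows linearly
  with the degree because \<open>d\<close> is integral.\<close>

lemma card_independent_on_line:
  fixes d :: "real^'n::finite"
  assumes d: "\<And>j. d $ j \<in> \<int>" "(\<Sum>j\<in>UNIV. \<bar>d $ j\<bar>) \<le> real D"
    and S: "\<And>x y. x \<in> S \<Longrightarrow> y \<in> S \<Longrightarrow> \<exists>c. x - y = c *\<^sub>R d"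
    and F: "F \<subseteq> tropical_monomials k" "\<And>f. f \<in> F \<Longrightarrow> v f \<in> S"
      "\<And>f. f \<in> F \<Longrightarrow> v f \<in> strict_region b F f"
  shows "card F \<le> 2 * k * D + 1"
proof -
  have "inj_on (\<lambda>f. f d) F"
  proof (rule inj_onI, rule ccontr)
    fix f g assume fg: "f \<in> F" "g \<in> F" "f d = g d" "f \<noteq> g"
    then have lin: "linear f" "linear g" using F(1) tropical_monomials_linear by blast+
    obtain c where c: "v f - v g = c *\<^sub>R d" using S F(2) fg by blast
    have "f (v f) - f (v g) = g (v f) - g (v g)"
      using c fg(3) lin by (metis linear_diff linear_cmul)
    moreover have "b f + f (v f) < b g + g (v f)" "b g + g (v g) < b f + f (v g)"
      using strict_region_less[OF F(3)] fg by auto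
    ultimately show False by linarith
  qed
  moreover have "(\<lambda>f. f d) ` F \<subseteq> real_of_int ` {- int (k * D)..int (k * D)}"
    using tropical_monomial_integer_bound[OF d] F(1) by blast
  ultimately have "card F \<le> card (real_of_int ` {- int (k * D)..int (k * D)})"
    by (metis card_image card_mono finite_atLeastAtMost_int finite_imageI)
  also have "\<dots> = nat (1 + 2 * int (k * D))"
    by (subst card_image) (auto simp: inj_on_def mult.commute)
  also have "\<dots> = 2 * k * D + 1" by (simp only: nat_eq_iff) simp
  finally show ?thesis .
qed

lemma tropical_hilbert_linear_bound:
  fixes V :: "(real^'n::finite) set"
  assumes "finite P" and "\<And>S. S \<in> P \<Longrightarrow> rational_polyhedron S \<and> aff_dim S \<le> 1"
    and "V = \<Union>P"
  obtains C where "\<And>k. tropical_hilbert V k \<le> C * k + card P"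
proof -
  have "\<exists>D. \<forall>k F b v. F \<subseteq> tropical_monomials k \<longrightarrow>
      (\<forall>f\<in>F. v f \<in> S \<inter> strict_region b F f) \<longrightarrow> card F \<le> 2 * k * D + 1"
    if SP: "S \<in> P" for S
  proof -
    obtain d :: "real^'n" where d: "\<And>j. d $ j \<in> \<int>"
        "\<And>x y. x \<in> S \<Longrightarrow> y \<in> S \<Longrightarrow> \<exists>c. x - y = c *\<^sub>R d"
      using rational_polyhedron_integer_direction assms(2)[OF SP] by metis
    obtain D where D: "(\<Sum>j\<in>UNIV. \<bar>d $ j\<bar>) \<le> real D" using real_arch_simple by blast
    show ?thesis
    proof (intro exI allI impI)
      fix k b and F :: "(real^'n \<Rightarrow> real) set" and v
      assume "F \<subseteq> tropical_monomials k" "\<forall>f\<in>F. v f \<in> S \<inter> strict_region b F f"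
      then show "card F \<le> 2 * k * D + 1"
        by (intro card_independent_on_line[OF d(1) D d(2), where b = b and v = v]) auto
    qed
  qed
  then obtain D where D: "\<And>S k F b v. S \<in> P \<Longrightarrow> F \<subseteq> tropical_monomials k \<Longrightarrow>
      (\<forall>f\<in>F. v f \<in> S \<inter> strict_region b F f) \<Longrightarrow> card F \<le> 2 * k * D S + 1"
    by metis
  show thesis
  proof (rule that[of "2 * (\<Sum>S\<in>P. D S)"])
    fix k
    obtain F where F: "F \<subseteq> tropical_monomials k" "tropically_independent V F"
        "card F = tropical_hilbert V k"
      using tropical_hilbert_attained(1) by blast
    obtain b v where bv: "\<And>f. f \<in> F \<Longrightarrow> v f \<in> V" "\<And>f. f \<in> F \<Longrightarrow> v f \<in> strict_region b F f"
      by (rule tropically_independentE[OF F(2)], rule that)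
    have "card F = card (\<Union>S\<in>P. {f\<in>F. v f \<in> S})"
      using bv(1) assms(3) by (intro arg_cong[of _ _ card]) auto
    also have "\<dots> \<le> (\<Sum>S\<in>P. card {f\<in>F. v f \<in> S})" by (rule card_UN_le[OF assms(1)])
    also have "\<dots> \<le> (\<Sum>S\<in>P. 2 * k * D S + 1)"
      by (intro sum_mono D[where b = b and v = v]) (use F(1) bv in \<open>auto simp: strict_region_def\<close>)
    also have "\<dots> = 2 * (\<Sum>S\<in>P. D S) * k + card P"
      unfolding sum.distrib by (simp add: sum_distrib_left[symmetric])
    finally show "tropical_hilbert V k \<le> 2 * (\<Sum>S\<in>P. D S) * k + card P" using F(3) by simp
  qed
qed

section \<open>Generic coefficients\<close>

text \<open>All pairwise coincidences count, not only those at the minimum: each is a single linear equation, which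
  makes the set easy to control under perturbation of \<open>b\<close>.\<close>

definition ties :: "'a set \<Rightarrow> (('a \<Rightarrow> real) \<Rightarrow> real) \<Rightarrow> ('a \<Rightarrow> real) set \<Rightarrow> 'a set" where
  "ties V b F = {x\<in>V. \<exists>f\<in>F. \<exists>g\<in>F. f \<noteq> g \<and> b f + f x = b g + g x}"

lemma open_strict_region:
  fixes F :: "('a::euclidean_space \<Rightarrow> real) set"
  assumes "finite F" "\<And>f. f \<in> F \<Longrightarrow> linear f" "f \<in> F"
  shows "open (strict_region b F f)"
proof -
  have "strict_region b F f = (\<Inter>g\<in>F-{f}. {x. b f + f x < b g + g x})"
    by (auto simp: strict_region_def)
  moreover have "continuous_on UNIV g" if "g \<in> F" for g
    using assms(2)[OF that] by (simp add: linear_continuous_on linear_conv_bounded_linear)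
  ultimately show ?thesis using assms(1,3)
    by (auto intro!: open_INT open_Collect_less continuous_intros)
qed

lemma strict_region_disjoint:
  assumes "f \<in> F" "g \<in> F" "x \<in> strict_region b F f" "x \<in> strict_region b F g"
  shows "f = g"
  using assms strict_region_less[of x b F f g] strict_region_less[of x b F g f] by force

lemma strict_region_cover:
  assumes "finite F" "F \<noteq> {}" "x \<in> V - ties V b F"
  obtains f where "f \<in> F" "x \<in> strict_region b F f"
proof -
  obtain f where f: "f \<in> F" "\<forall>g\<in>F. b f + f x \<le> b g + g x"
    using ex_is_arg_min_if_finite[OF assms(1,2), of "\<lambda>f. b f + f x"]
    by (force simp: is_arg_min_linorder)
  then have "x \<in> strict_region b F f"
    using assms(3) by (force simp: strict_region_def ties_def)
  with f(1) show thesis by (rule that)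
qed

text \<open>Replace \<open>b f\<close> by \<open>b f + \<epsilon> w(f)\<close> with \<open>w\<close> injective on \<open>F\<close>. For small \<open>\<epsilon> > 0\<close> the strict inequalities at
  the points \<open>v f\<close> persist. Two distinct members \<open>f, g\<close> tie on a line either in at most one point or,
  if their difference is constant there, only when the value of \<open>\<epsilon>\<close> satisfies one nontrivial linear
  equation; and they tie at a given point of \<open>X\<close> for only one value of \<open>\<epsilon>\<close>. So almost every small \<open>\<epsilon>\<close>
  works.\<close>

lemma generic_coefficients:
  fixes V :: "'a::euclidean_space set"
  assumes P: "finite P" "\<And>S. S \<in> P \<Longrightarrow> collinear S" "V = \<Union>P"
    and F: "finite F" "\<And>f. f \<in> F \<Longrightarrow> linear f"
    and v: "\<And>f. f \<in> F \<Longrightarrow> v f \<in> strict_region b F f"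
    and X: "finite X"
  obtains b' where "\<And>f. f \<in> F \<Longrightarrow> v f \<in> strict_region b' F f"
    "finite (ties V b' F)" "ties V b' F \<inter> X = {}"
proof -
  obtain w0 :: "('a \<Rightarrow> real) \<Rightarrow> nat" where "inj_on w0 F"
    using finite_imp_inj_to_nat_seg[OF F(1)] by blast
  define w where "w f = real (w0 f)" for f
  have w: "w f - w g \<noteq> 0" if "f \<in> F" "g \<in> F" "f \<noteq> g" for f g
    using that \<open>inj_on w0 F\<close> by (auto simp: w_def inj_on_def)
  define B where "B \<epsilon> f = b f + \<epsilon> * w f" for \<epsilon> f
  have tie_iff: "B \<epsilon> f + f x = B \<epsilon> g + g x \<longleftrightarrow> (b f + f x - b g - g x) + \<epsilon> * (w f - w g) = 0"
    for \<epsilon> f g x by (auto simp: B_def algebra_simps)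
  have strict: "\<forall>\<^sub>F \<epsilon> in at_right 0. B \<epsilon> f + f (v f) < B \<epsilon> g + g (v f)"
    if "f \<in> F" "g \<in> F" "g \<noteq> f" for f g
    using eventually_perturbed_less[OF strict_region_less[OF v[OF that(1)] that(2,3)], of "w f" "w g"]
    by eventually_elim (simp add: B_def algebra_simps)
  have avoid: "\<forall>\<^sub>F \<epsilon> in at_right 0. B \<epsilon> f + f x \<noteq> B \<epsilon> g + g x"
    if "f \<in> F" "g \<in> F" "f \<noteq> g" for f g x
    using eventually_affine_nonzero[OF w[OF that]] unfolding tie_iff .
  have fin: "\<forall>\<^sub>F \<epsilon> in at_right 0. finite {x\<in>S. B \<epsilon> f + f x = B \<epsilon> g + g x}"
    if fg: "f \<in> F" "g \<in> F" "f \<noteq> g" and "S \<in> P" for f g S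
  proof -
    obtain u where u: "\<And>x y. x \<in> S \<Longrightarrow> y \<in> S \<Longrightarrow> \<exists>c. x - y = c *\<^sub>R u"
      using P(2)[OF \<open>S \<in> P\<close>] unfolding collinear_def by blast
    have diff: "\<exists>c. x - y = c *\<^sub>R u \<and> (f x - g x) - (f y - g y) = c * (f u - g u)"
      if xy: "x \<in> S" "y \<in> S" for x y
    proof -
      obtain c where c: "x - y = c *\<^sub>R u" using u xy by blast
      have "f x - f y = c * f u" "g x - g y = c * g u"
        using c F(2)[OF fg(1)] F(2)[OF fg(2)] by (metis linear_diff linear_cmul real_scaleR_def)+
      with c show ?thesis by (auto simp: algebra_simps)
    qed
    show ?thesis
    proof (cases "f u = g u")
      case False
      have "finite {x\<in>S. B \<epsilon> f + f x = B \<epsilon> g + g x}" for \<epsilon>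
      proof -
        have "x = y" if xy: "x \<in> {x\<in>S. B \<epsilon> f + f x = B \<epsilon> g + g x}"
          "y \<in> {x\<in>S. B \<epsilon> f + f x = B \<epsilon> g + g x}" for x y
        proof -
          obtain c where c: "x - y = c *\<^sub>R u" "(f x - g x) - (f y - g y) = c * (f u - g u)"
            using diff xy by blast
          have "(f x - g x) - (f y - g y) = 0" using xy by simp
          with c False show ?thesis by simp
        qed
        then show ?thesis by (metis (no_types, lifting) finite.simps is_singletonI' is_singleton_def)
      qed
      then show ?thesis by simp
    next
      case True
      show ?thesis
      proof (cases "S = {}")
        case False
        then obtain y where y: "y \<in> S" by blast
        have "f x - g x = f y - g y" if "x \<in> S" for x using diff[OF that y] True by auto
        then have eq: "B \<epsilon> f + f x = B \<epsilon> g + g x \<longleftrightarrow> B \<epsilon> f + f y = B \<epsilon> g + g y" if "x \<in> S" for x \<epsilon>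
          using that by (smt (verit))
        from avoid[OF fg, of y] show ?thesis
        proof eventually_elim
          case (elim \<epsilon>)
          then have "{x\<in>S. B \<epsilon> f + f x = B \<epsilon> g + g x} = {}" using eq by blast
          then show ?case by (metis finite.emptyI)
        qed
      qed simp
    qed
  qed
  have "\<forall>\<^sub>F \<epsilon> in at_right 0. \<forall>f\<in>F. \<forall>g\<in>F. f \<noteq> g \<longrightarrow>
      B \<epsilon> f + f (v f) < B \<epsilon> g + g (v f) \<and>
      (\<forall>S\<in>P. finite {x\<in>S. B \<epsilon> f + f x = B \<epsilon> g + g x}) \<and>
      (\<forall>x\<in>X. B \<epsilon> f + f x \<noteq> B \<epsilon> g + g x)"
  proof (intro eventually_ball_finite ballI F(1))
    fix f g assume fg: "f \<in> F" "g \<in> F"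
    show "\<forall>\<^sub>F \<epsilon> in at_right 0. f \<noteq> g \<longrightarrow>
      B \<epsilon> f + f (v f) < B \<epsilon> g + g (v f) \<and>
      (\<forall>S\<in>P. finite {x\<in>S. B \<epsilon> f + f x = B \<epsilon> g + g x}) \<and>
      (\<forall>x\<in>X. B \<epsilon> f + f x \<noteq> B \<epsilon> g + g x)"
    proof (cases "f = g")
      case False
      then have "\<forall>\<^sub>F \<epsilon> in at_right 0. B \<epsilon> f + f (v f) < B \<epsilon> g + g (v f) \<and>
        (\<forall>S\<in>P. finite {x\<in>S. B \<epsilon> f + f x = B \<epsilon> g + g x}) \<and>
        (\<forall>x\<in>X. B \<epsilon> f + f x \<noteq> B \<epsilon> g + g x)"
        using fg strict fin avoid P(1) X
        by (intro eventually_conj eventually_ball_finite ballI) auto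
      then show ?thesis by eventually_elim simp
    qed simp
  qed
  from eventually_happens'[OF trivial_limit_at_right_real this]
  obtain \<epsilon> where all: "\<forall>f\<in>F. \<forall>g\<in>F. f \<noteq> g \<longrightarrow>
      B \<epsilon> f + f (v f) < B \<epsilon> g + g (v f) \<and>
      (\<forall>S\<in>P. finite {x\<in>S. B \<epsilon> f + f x = B \<epsilon> g + g x}) \<and>
      (\<forall>x\<in>X. B \<epsilon> f + f x \<noteq> B \<epsilon> g + g x)" ..
  have \<epsilon>: "B \<epsilon> f + f (v f) < B \<epsilon> g + g (v f)"
      "\<And>S. S \<in> P \<Longrightarrow> finite {x\<in>S. B \<epsilon> f + f x = B \<epsilon> g + g x}"
      "\<And>x. x \<in> X \<Longrightarrow> B \<epsilon> f + f x \<noteq> B \<epsilon> g + g x"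
    if "f \<in> F" "g \<in> F" "f \<noteq> g" for f g
    using all[rule_format, OF that] by auto
  show thesis
  proof (rule that[of "B \<epsilon>"])
    show "v f \<in> strict_region (B \<epsilon>) F f" if "f \<in> F" for f
      using \<epsilon>(1) that by (simp add: strict_region_def)
    have "ties V (B \<epsilon>) F \<subseteq> (\<Union>S\<in>P. \<Union>f\<in>F. \<Union>g\<in>F-{f}. {x\<in>S. B \<epsilon> f + f x = B \<epsilon> g + g x})"
    proof
      fix x assume "x \<in> ties V (B \<epsilon>) F"
      then obtain S f g where "S \<in> P" "f \<in> F" "g \<in> F - {f}" "x \<in> S" "B \<epsilon> f + f x = B \<epsilon> g + g x"
        unfolding ties_def P(3) by blast
      then show "x \<in> (\<Union>S\<in>P. \<Union>f\<in>F. \<Union>g\<in>F-{f}. {x\<in>S. B \<epsilon> f + f x = B \<epsilon> g + g x})"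
        by (intro UN_I CollectI conjI)
    qed
    moreover have "finite \<dots>"
      using \<epsilon>(2) by (intro finite_UN_I finite_Diff P(1) F(1)) auto
    ultimately show "finite (ties V (B \<epsilon>) F)" by (rule finite_subset)
    show "ties V (B \<epsilon>) F \<inter> X = {}" using \<epsilon>(3) by (auto simp: ties_def)
  qed
qed

section \<open>Counting edges in unions of connected bipartite graphs\<close>

text \<open>A relation is a set of edges of a bipartite graph on the disjoint union of the two types; \<open>linked\<close> says
  that this graph, apart from isolated vertices, is connected. It is phrased as: every nonempty proper
  set of edges can be extended by an edge sharing an endpoint with it.\<close>

definition linked :: "('a \<times> 'b) set \<Rightarrow> bool" where
  "linked E \<longleftrightarrow> (\<forall>A\<subset>E. A \<noteq> {} \<longrightarrow> (\<exists>a\<in>A. \<exists>e\<in>E - A. fst a = fst e \<or> snd a = snd e))"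

text \<open>Adding the edges of \<open>E\<close> to \<open>A\<close> one at a time: the first edge adds at most two new vertices and, if
  it adds any, is itself new; every later edge can be chosen to share an endpoint with an earlier one and
  so adds at most one new vertex. Hence vertices minus edges grows by at most one.\<close>

lemma linked_adds_one_component:
  assumes "finite E" "linked E" "finite A"
  shows "card (fst ` (A \<union> E)) + card (snd ` (A \<union> E)) + card A
    \<le> card (A \<union> E) + card (fst ` A) + card (snd ` A) + 1"
proof (cases "E = {}")
  case False
  define ok where "ok B \<longleftrightarrow> B \<noteq> {} \<and> B \<subseteq> E \<and> card (fst ` (A \<union> B)) + card (snd ` (A \<union> B)) + card A
    \<le> card (A \<union> B) + card (fst ` A) + card (snd ` A) + 1" for B
  obtain e where "e \<in> E" using False by blast
  have "ok {e}"
    unfolding ok_def using assms(3) \<open>e \<in> E\<close>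
    by (cases "e \<in> A") (simp_all add: insert_absorb card_insert_if)
  then obtain B where B: "ok B" "\<And>B'. ok B' \<Longrightarrow> card B' \<le> card B"
    using ex_has_greatest_nat[of ok "{e}" card "Suc (card E)"] assms(1)
    by (metis card_mono less_Suc_eq_le ok_def)
  have "B = E"
  proof (rule ccontr)
    assume "B \<noteq> E"
    then obtain a e where ae: "a \<in> B" "e \<in> E - B" "fst a = fst e \<or> snd a = snd e"
      using assms(2) B(1) unfolding linked_def ok_def by (meson psubsetI)
    have fin: "finite B" using B(1) assms(1) finite_subset unfolding ok_def by blast
    have "ok (insert e B)"
    proof (cases "e \<in> A")
      case True
      then show ?thesis using B(1) ae(2) by (simp add: ok_def insert_absorb)
    next
      case False
      have "fst e \<in> fst ` (A \<union> B) \<or> snd e \<in> snd ` (A \<union> B)" using ae(1,3) by (metis UnI2 imageI)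
      then show ?thesis using B(1) ae(2) False fin assms(3)
        by (auto simp: ok_def card_insert_if)
    qed
    from B(2)[OF this] show False using ae(2) fin by simp
  qed
  then show ?thesis using B(1) by (simp add: ok_def)
qed simp

text \<open>The inequality \<open>vertices \<le> edges + components\<close> for a union of \<open>card P\<close> connected bipartite graphs.\<close>

lemma card_union_of_linked:
  assumes "finite P" "\<And>S. S \<in> P \<Longrightarrow> finite (E S)" "\<And>S. S \<in> P \<Longrightarrow> linked (E S)"
  shows "card (fst ` (\<Union>S\<in>P. E S)) + card (snd ` (\<Union>S\<in>P. E S)) \<le> card (\<Union>S\<in>P. E S) + card P"
  using assms
proof (induction P rule: finite_induct)
  case (insert S P)
  let ?A = "\<Union>S\<in>P. E S"
  have "card (fst ` (?A \<union> E S)) + card (snd ` (?A \<union> E S)) + card ?A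
    \<le> card (?A \<union> E S) + card (fst ` ?A) + card (snd ` ?A) + 1"
    by (rule linked_adds_one_component) (use insert in auto)
  moreover have "(\<Union>S\<in>insert S P. E S) = ?A \<union> E S" by blast
  ultimately show ?case using insert by simp
qed simp

text \<open>If the overlaps split into two classes \<open>A\<close> and \<open>E - A\<close>, the parts of \<open>S\<close> lying in overlaps of each
  class have closures covering \<open>S\<close>: removing finitely many points from a connected set with more
  than one point leaves a dense set. By connectedness the closures share a point \<open>z\<close>. As \<open>Y\<close> and \<open>Z\<close> are
  disjoint, \<open>z\<close> lies in some \<open>U i\<close> or in some \<open>W j\<close>; this open neighbourhood of \<open>z\<close> meets both classes, and
  its index is a common coordinate of a member of \<open>A\<close> and a member of \<open>E - A\<close>.\<close>

lemma linked_overlaps: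
  fixes S :: "'a::euclidean_space set"
  assumes S: "connected S"
    and I: "finite I" "\<And>i. i \<in> I \<Longrightarrow> open (U i)"
      "\<And>i i' x. i \<in> I \<Longrightarrow> i' \<in> I \<Longrightarrow> x \<in> U i \<Longrightarrow> x \<in> U i' \<Longrightarrow> i = i'"
    and J: "finite J" "\<And>j. j \<in> J \<Longrightarrow> open (W j)"
      "\<And>j j' x. j \<in> J \<Longrightarrow> j' \<in> J \<Longrightarrow> x \<in> W j \<Longrightarrow> x \<in> W j' \<Longrightarrow> j = j'"
    and Y: "finite Y" "S - Y \<subseteq> (\<Union>i\<in>I. U i)"
    and Z: "finite Z" "S - Z \<subseteq> (\<Union>j\<in>J. W j)"
    and YZ: "Y \<inter> Z = {}"
  shows "linked {(i, j) \<in> I \<times> J. S \<inter> U i \<inter> W j \<noteq> {}}"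
proof -
  define E where "E = {(i, j) \<in> I \<times> J. S \<inter> U i \<inter> W j \<noteq> {}}"
  have E: "(i, j) \<in> E \<longleftrightarrow> i \<in> I \<and> j \<in> J \<and> S \<inter> U i \<inter> W j \<noteq> {}" for i j
    by (simp add: E_def)
  define R where "R A = (\<Union>(i, j)\<in>A. S \<inter> U i \<inter> W j)" for A
  have "\<exists>a\<in>A. \<exists>e\<in>E - A. fst a = fst e \<or> snd a = snd e" if A: "A \<subset> E" "A \<noteq> {}" for A
  proof -
    have "\<exists>x. x \<in> R B" if B: "B \<subseteq> E" "B \<noteq> {}" for B
    proof -
      obtain i j where ij: "(i, j) \<in> B" using B(2) by auto
      with B(1) E have "S \<inter> U i \<inter> W j \<noteq> {}" by blast
      with ij show ?thesis unfolding R_def by blast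
    qed
    note nonempty = this
    have "A \<subseteq> E" "E - A \<subseteq> E" "E - A \<noteq> {}" using A(1) by blast+
    then obtain x y where x: "x \<in> R A" and y: "y \<in> R (E - A)"
      using nonempty A(2) by meson
    have Sxy: "x \<in> S" "y \<in> S" using x y by (auto simp: R_def)
    \<comment> \<open>A point lies in only one overlap, so \<open>S\<close> has two points and finite sets can be removed.\<close>
    have xy: "x \<noteq> y"
    proof
      assume "x = y"
      obtain i j where ij: "(i, j) \<in> A" "x \<in> U i" "x \<in> W j" using x by (auto simp: R_def)
      obtain i' j' where ij': "(i', j') \<in> E - A" "x \<in> U i'" "x \<in> W j'"
        using y \<open>x = y\<close> by (auto simp: R_def)
      have "i \<in> I" "j \<in> J" "i' \<in> I" "j' \<in> J" using ij(1) ij'(1) \<open>A \<subseteq> E\<close> E by blast+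
      then have "i = i'" "j = j'"
        using I(3)[OF _ _ ij(2) ij'(2)] J(3)[OF _ _ ij(3) ij'(3)] by blast+
      then show False using ij ij' by blast
    qed
    have split: "S - (Y \<union> Z) \<subseteq> R A \<union> R (E - A)"
    proof
      fix z assume z: "z \<in> S - (Y \<union> Z)"
      then obtain i j where "i \<in> I" "z \<in> U i" "j \<in> J" "z \<in> W j" using Y(2) Z(2) by blast
      then have "(i, j) \<in> E" "z \<in> S \<inter> U i \<inter> W j" using z E by auto
      then show "z \<in> R A \<union> R (E - A)" unfolding R_def by blast
    qed
    have "S \<subseteq> closure (S - (Y \<union> Z))"
    proof
      fix z assume z: "z \<in> S"
      have "z islimpt S" using connected_imp_perfect[OF S z] Sxy xy by blast
      then have "z islimpt ((Y \<union> Z) \<union> (S - (Y \<union> Z)))"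
        by (rule islimpt_subset) blast
      then have "z islimpt (S - (Y \<union> Z))"
        using Y(1) Z(1) by (metis finite_Un islimpt_Un_finite)
      then show "z \<in> closure (S - (Y \<union> Z))" by (simp add: closure_def)
    qed
    also have "\<dots> \<subseteq> closure (R A) \<union> closure (R (E - A))"
      using closure_mono[OF split] by simp
    finally have "S \<subseteq> closure (R A) \<union> closure (R (E - A))" .
    moreover have "x \<in> closure (R A)" "y \<in> closure (R (E - A))"
      using x y closure_subset by blast+
    ultimately obtain z where z: "z \<in> S" "z \<in> closure (R A)" "z \<in> closure (R (E - A))"
      using connected_closedD[OF S, of "closure (R A)" "closure (R (E - A))"] Sxy by auto
    have meets: "\<exists>y\<in>R A. y \<in> T" "\<exists>y\<in>R (E - A). y \<in> T" if "open T" "z \<in> T" for T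
      using that z(2,3) by (metis IntI closure_iff_nhds_not_empty disjoint_iff order_refl)+
    from YZ consider "z \<notin> Y" | "z \<notin> Z" by blast
    then show ?thesis
    proof cases
      case 1
      then obtain i where i: "i \<in> I" "z \<in> U i" using Y(2) z(1) by blast
      obtain p where p: "p \<in> R A" "p \<in> U i" using meets(1)[OF I(2)] i by blast
      obtain q where q: "q \<in> R (E - A)" "q \<in> U i" using meets(2)[OF I(2)] i by blast
      obtain i1 j1 where 11: "(i1, j1) \<in> A" "p \<in> U i1" using p by (auto simp: R_def)
      obtain i2 j2 where 22: "(i2, j2) \<in> E - A" "q \<in> U i2" using q by (auto simp: R_def)
      have "i1 \<in> I" "i2 \<in> I" using 11(1) 22(1) \<open>A \<subseteq> E\<close> E by blast+
      then have "i1 = i" "i2 = i"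
        using I(3)[OF _ i(1) 11(2) p(2)] I(3)[OF _ i(1) 22(2) q(2)] by blast+
      then show ?thesis using 11(1) 22(1) by (metis fst_conv)
    next
      case 2
      then obtain j where j: "j \<in> J" "z \<in> W j" using Z(2) z(1) by blast
      obtain p where p: "p \<in> R A" "p \<in> W j" using meets(1)[OF J(2)] j by blast
      obtain q where q: "q \<in> R (E - A)" "q \<in> W j" using meets(2)[OF J(2)] j by blast
      obtain i1 j1 where 11: "(i1, j1) \<in> A" "p \<in> W j1" using p by (auto simp: R_def)
      obtain i2 j2 where 22: "(i2, j2) \<in> E - A" "q \<in> W j2" using q by (auto simp: R_def)
      have "j1 \<in> J" "j2 \<in> J" using 11(1) 22(1) \<open>A \<subseteq> E\<close> E by blast+
      then have "j1 = j" "j2 = j"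
        using J(3)[OF _ j(1) 11(2) p(2)] J(3)[OF _ j(1) 22(2) q(2)] by blast+
      then show ?thesis using 11(1) 22(1) by (metis snd_conv)
    qed
  qed
  then show ?thesis unfolding linked_def E_def by blast
qed

section \<open>Superadditivity of the tropical Hilbert function\<close>

text \<open>Wherever \<open>f\<close> and \<open>g\<close> are both strict minimizers, \<open>f + g\<close> has the coefficient \<open>b f + c g\<close> and beats
  every other sum. Two pairs in \<open>E\<close> with the same sum would each need a strictly smaller coefficient than
  the other, so the sums are distinct.\<close>

lemma independent_products:
  fixes V :: "(real^'n::finite) set"
  assumes "finite E" "E \<subseteq> F \<times> G"
    and ov: "\<And>f g. (f, g) \<in> E \<Longrightarrow> \<exists>x\<in>V. x \<in> strict_region b F f \<and> x \<in> strict_region c G g"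
  shows "inj_on (\<lambda>(f, g) x. f x + g x) E"
    and "tropically_independent V ((\<lambda>(f, g) x. f x + g x) ` E)"
proof -
  let ?m = "\<lambda>(f, g) x. f x + g x :: real"
  obtain y where y: "\<And>f g. (f, g) \<in> E \<Longrightarrow> y (f, g) \<in> V \<and>
      y (f, g) \<in> strict_region b F f \<and> y (f, g) \<in> strict_region c G g"
  proof -
    have "\<forall>e\<in>E. \<exists>x. x \<in> V \<and> x \<in> strict_region b F (fst e) \<and> x \<in> strict_region c G (snd e)"
      using ov by fastforce
    then show thesis using that by (metis fst_conv snd_conv)
  qed
  have less: "b f + c g + ?m (f, g) (y (f, g)) < b f' + c g' + ?m (f', g') (y (f, g))"
    if E: "(f, g) \<in> E" "(f', g') \<in> E" and ne: "(f, g) \<noteq> (f', g')" for f g f' g'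
  proof -
    have F: "f' \<in> F" "g' \<in> G" using E(2) assms(2) by auto
    have "f' \<noteq> f \<Longrightarrow> b f + f (y (f, g)) < b f' + f' (y (f, g))"
      "g' \<noteq> g \<Longrightarrow> c g + g (y (f, g)) < c g' + g' (y (f, g))"
      using strict_region_less[of "y (f, g)" b F f f'] strict_region_less[of "y (f, g)" c G g g']
        y[OF E(1)] F by auto
    then show ?thesis using ne by (cases "f' = f"; cases "g' = g") auto
  qed
  show inj: "inj_on ?m E"
  proof (rule inj_onI, rule ccontr)
    fix e e' assume e: "e \<in> E" "e' \<in> E" "?m e = ?m e'" "e \<noteq> e'"
    obtain f g f' g' where [simp]: "e = (f, g)" "e' = (f', g')" by (cases e, cases e') blast
    have eq: "f x + g x = f' x + g' x" for x using fun_cong[OF e(3), of x] by simp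
    have "b f + c g < b f' + c g'" "b f' + c g' < b f + c g"
      using less[of f g f' g'] less[of f' g' f g] e(1,2,4) eq by force+
    then show False by simp
  qed
  define r where "r = the_inv_into E ?m"
  have r: "r (?m e) = e" if "e \<in> E" for e
    unfolding r_def using inj that by (rule the_inv_into_f_f)
  show "tropically_independent V (?m ` E)"
    unfolding tropically_independent_def
  proof (intro conjI exI[of _ "\<lambda>h. b (fst (r h)) + c (snd (r h))"] exI[of _ "\<lambda>h. y (r h)"] ballI impI)
    show "finite (?m ` E)" using assms(1) by simp
    fix h assume "h \<in> ?m ` E"
    then obtain e where "e \<in> E" "h = ?m e" by (rule imageE)
    then obtain f g where fg: "(f, g) \<in> E" "h = ?m (f, g)" by (cases e) blast
    then show "y (r h) \<in> V" using r[OF fg(1)] y by simp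
    fix h' assume "h' \<in> ?m ` E" "h' \<noteq> h"
    then obtain e' where "e' \<in> E" "h' = ?m e'" "h' \<noteq> h" by auto
    then obtain f' g' where fg': "(f', g') \<in> E" "h' = ?m (f', g')" by (cases e') blast
    have "(f, g) \<noteq> (f', g')" using \<open>h' \<noteq> h\<close> fg(2) fg'(2) by metis
    from less[OF fg(1) fg'(1) this]
    show "b (fst (r h)) + c (snd (r h)) + h (y (r h)) < b (fst (r h')) + c (snd (r h')) + h' (y (r h))"
      unfolding fg(2) fg'(2) r[OF fg(1)] r[OF fg'(1)] by simp
  qed
qed

lemma tropical_hilbert_mono:
  fixes V :: "(real^'n::finite) set"
  assumes "k \<le> l"
  shows "tropical_hilbert V k \<le> tropical_hilbert V l"
proof -
  obtain F where F: "F \<subseteq> tropical_monomials k" "tropically_independent V F"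
      "card F = tropical_hilbert V k"
    using tropical_hilbert_attained(1) by blast
  have "tropical_monomials k \<subseteq> (tropical_monomials l :: (real^'n \<Rightarrow> real) set)"
    using assms by (force simp: tropical_monomials_def)
  then show ?thesis using tropical_hilbert_attained(2)[of F l V] F by auto
qed

text \<open>Take independent \<open>F\<close> and \<open>G\<close> of maximal size in degrees \<open>k\<close> and \<open>l\<close>, with generic coefficients such that
  their ties on \<open>V\<close> are finitely many and disjoint. Join \<open>f\<close> and \<open>g\<close> by an edge if their strict regions meet
  on \<open>V\<close>. The sums \<open>f + g\<close> along the edges form an independent family of degree \<open>k + l\<close>. Each polyhedron
  contributes a connected set of edges, and no vertex is isolated, so there are at least
  \<open>card F + card G - card P\<close> edges.\<close>

lemma tropical_hilbert_superadditive:
  fixes V :: "(real^'n::finite) set"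
  assumes P: "finite P" "\<And>S. S \<in> P \<Longrightarrow> convex S \<and> collinear S" "V = \<Union>P"
  shows "tropical_hilbert V k + tropical_hilbert V l \<le> tropical_hilbert V (k + l) + card P"
proof -
  obtain F where F: "F \<subseteq> tropical_monomials k" "tropically_independent V F"
      "card F = tropical_hilbert V k"
    using tropical_hilbert_attained(1) by blast
  obtain G where G: "G \<subseteq> tropical_monomials l" "tropically_independent V G"
      "card G = tropical_hilbert V l"
    using tropical_hilbert_attained(1) by blast
  obtain b0 v where v: "finite F" "\<And>f. f \<in> F \<Longrightarrow> v f \<in> V"
      "\<And>f. f \<in> F \<Longrightarrow> v f \<in> strict_region b0 F f"
    by (rule tropically_independentE[OF F(2)], rule that)
  obtain c0 w where w: "finite G" "\<And>g. g \<in> G \<Longrightarrow> w g \<in> V"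
      "\<And>g. g \<in> G \<Longrightarrow> w g \<in> strict_region c0 G g"
    by (rule tropically_independentE[OF G(2)], rule that)
  have lin: "linear f" if "f \<in> F \<union> G" for f using that F(1) G(1) tropical_monomials_linear by blast
  obtain b where b: "\<And>f. f \<in> F \<Longrightarrow> v f \<in> strict_region b F f"
      "finite (ties V b F)" "ties V b F \<inter> (w ` G) = {}"
    using generic_coefficients[of P V F v b0 "w ` G"] P v(1,3) w(1) lin by blast
  \<comment> \<open>The ties of \<open>G\<close> must avoid those of \<open>F\<close>, so that only one member of a pair changes at a time; each
    family must also avoid the witnesses of the other, so that each vertex lies on an edge.\<close>
  obtain c where c: "\<And>g. g \<in> G \<Longrightarrow> w g \<in> strict_region c G g"
      "finite (ties V c G)" "ties V c G \<inter> (ties V b F \<union> v ` F) = {}"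
    using generic_coefficients[of P V G w c0 "ties V b F \<union> v ` F"] P v(1) w(1,3) lin b(2) by blast
  define E where "E S = {(f, g) \<in> F \<times> G. S \<inter> strict_region b F f \<inter> strict_region c G g \<noteq> {}}" for S
  define U where "U = (\<Union>S\<in>P. E S)"
  show ?thesis
  proof (cases "F = {} \<or> G = {}")
    case True
    have "tropical_hilbert V k \<le> tropical_hilbert V (k + l)" "tropical_hilbert V l \<le> tropical_hilbert V (k + l)"
      by (rule tropical_hilbert_mono, simp)+
    then show ?thesis using True F(3) G(3) by auto
  next
    case False
    have EFG: "E S \<subseteq> F \<times> G" for S unfolding E_def by blast
    then have finE: "finite (E S)" for S
      by (rule finite_subset) (simp add: v(1) w(1))
    have linkE: "linked (E S)" if S: "S \<in> P" for S
    proof -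
      have SV: "S \<subseteq> V" using S P(3) by blast
      have covF: "S - ties V b F \<subseteq> (\<Union>f\<in>F. strict_region b F f)"
      proof
        fix x assume "x \<in> S - ties V b F"
        then have "x \<in> V - ties V b F" using SV by blast
        then obtain f where "f \<in> F" "x \<in> strict_region b F f"
          using strict_region_cover[OF v(1), of x V b] False by blast
        then show "x \<in> (\<Union>f\<in>F. strict_region b F f)" by blast
      qed
      have covG: "S - ties V c G \<subseteq> (\<Union>g\<in>G. strict_region c G g)"
      proof
        fix x assume "x \<in> S - ties V c G"
        then have "x \<in> V - ties V c G" using SV by blast
        then obtain g where "g \<in> G" "x \<in> strict_region c G g"
          using strict_region_cover[OF w(1), of x V c] False by blast
        then show "x \<in> (\<Union>g\<in>G. strict_region c G g)" by blast
      qed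
      have "connected S" using P(2)[OF S] convex_connected by blast
      then show ?thesis
        unfolding E_def
      proof (rule linked_overlaps[OF _ v(1) _ _ w(1) _ _ b(2) covF c(2) covG])
        show "open (strict_region b F f)" if "f \<in> F" for f
          using lin that by (intro open_strict_region v(1)) auto
        show "open (strict_region c G g)" if "g \<in> G" for g
          using lin that by (intro open_strict_region w(1)) auto
        show "ties V b F \<inter> ties V c G = {}" using c(3) by blast
      qed (rule strict_region_disjoint, assumption+)+
    qed
    have fst: "F \<subseteq> fst ` U"
    proof
      fix f assume f: "f \<in> F"
      then have "v f \<in> V - ties V c G" using v(2) c(3) by blast
      then obtain g where "g \<in> G" "v f \<in> strict_region c G g"
        using strict_region_cover[OF w(1)] False by blast
      then have "(f, g) \<in> U" using f b(1)[OF f] v(2)[OF f] P(3) unfolding U_def E_def by blast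
      then show "f \<in> fst ` U" by force
    qed
    have snd: "G \<subseteq> snd ` U"
    proof
      fix g assume g: "g \<in> G"
      then have "w g \<in> V - ties V b F" using w(2) b(3) by blast
      then obtain f where "f \<in> F" "w g \<in> strict_region b F f"
        using strict_region_cover[OF v(1)] False by blast
      then have "(f, g) \<in> U" using g c(1)[OF g] w(2)[OF g] P(3) unfolding U_def E_def by blast
      then show "g \<in> snd ` U" by force
    qed
    have U: "finite U" "U \<subseteq> F \<times> G"
      unfolding U_def using finE EFG P(1) by (blast intro: finite_UN_I)+
    have ov: "\<exists>x\<in>V. x \<in> strict_region b F f \<and> x \<in> strict_region c G g" if "(f, g) \<in> U" for f g
      using that P(3) unfolding U_def E_def by blast
    let ?m = "\<lambda>(f, g) x. f x + g x :: real"
    have "?m ` U \<subseteq> tropical_monomials (k + l)"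
    proof (rule image_subsetI)
      fix e assume "e \<in> U"
      then obtain f g where "e = (f, g)" "f \<in> F" "g \<in> G" using U(2) by blast
      then show "?m e \<in> tropical_monomials (k + l)"
        using F(1) G(1) tropical_monomials_add[of f k g l] by auto
    qed
    then have "card (?m ` U) \<le> tropical_hilbert V (k + l)"
      using independent_products(2)[OF U ov] by (rule tropical_hilbert_attained(2))
    moreover have "card (?m ` U) = card U"
      using independent_products(1)[OF U ov] by (rule card_image)
    moreover have "card F + card G \<le> card (fst ` U) + card (snd ` U)"
      using fst snd U(1) by (intro add_mono card_mono) auto
    moreover have "card (fst ` U) + card (snd ` U) \<le> card U + card P"
      unfolding U_def by (rule card_union_of_linked[OF P(1) finE linkE])
    ultimately show ?thesis using F(3) G(3) by linarith
  qed
qed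

section \<open>Existence of the limit\<close>

text \<open>Fekete's lemma: the limit is the supremum \<open>L\<close> of \<open>a n / n\<close> over \<open>n \<ge> 1\<close>. For fixed \<open>m\<close>, division with
  remainder \<open>n = q m + r\<close> gives \<open>a n \<ge> q a m + a r\<close>, so \<open>a n / n\<close> is at least \<open>a m / m\<close> up to an error
  \<open>O(1/n)\<close>.\<close>

lemma superadditive_convergent:
  fixes a :: "nat \<Rightarrow> real"
  assumes super: "\<And>m n. a m + a n \<le> a (m + n)" and bound: "\<And>n. a n \<le> C * real n"
  shows "convergent (\<lambda>n. a n / real n)"
proof -
  let ?A = "(\<lambda>n. a n / real n) ` {1..}"
  have bdd: "bdd_above ?A"
    using bound by (intro bdd_aboveI[of _ C]) (auto simp: divide_le_eq)
  define L where "L = Sup ?A"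
  have upper: "a n / real n \<le> L" if "n \<ge> 1" for n
    unfolding L_def using that bdd by (intro cSup_upper) auto
  have mult: "real (Suc q) * a m \<le> a (Suc q * m)" for q m
  proof (induction q)
    case (Suc q)
    then show ?case using super[of m "Suc q * m"] by (simp add: algebra_simps)
  qed simp
  have lower: "\<exists>K. \<forall>n\<ge>m. a m / real m - K / real n \<le> a n / real n" if m: "m \<ge> 1" for m
  proof -
    define c where "c = Min (a ` {..<m})"
    have c: "c \<le> a r" if "r < m" for r unfolding c_def using that by (intro Min_le) auto
    have "a m / real m - (\<bar>a m\<bar> + \<bar>c\<bar>) / real n \<le> a n / real n" if n: "n \<ge> m" for n
    proof -
      define q r where "q = n div m" and "r = n mod m"
      have r: "r < m" using m by (simp add: r_def)
      have nqr: "n = q * m + r" by (simp add: q_def r_def)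
      have "q \<ge> 1" using m n by (simp add: q_def div_greater_zero_iff Suc_le_eq)
      then have "real q * a m \<le> a (q * m)" using mult[of "q - 1" m] by simp
      then have 1: "real q * a m + c \<le> a n" using super[of "q * m" r] c[OF r] nqr by simp
      have "real n * (a m / real m) = real q * a m + (real r / real m) * a m"
        using m unfolding nqr by (simp add: field_simps)
      moreover have "(real r / real m) * a m \<le> \<bar>a m\<bar>"
      proof -
        have "(real r / real m) * a m \<le> (real r / real m) * \<bar>a m\<bar>"
          by (intro mult_left_mono) auto
        also have "\<dots> \<le> 1 * \<bar>a m\<bar>" using r m by (intro mult_right_mono) auto
        finally show ?thesis by simp
      qed
      ultimately have "real n * (a m / real m) - (\<bar>a m\<bar> + \<bar>c\<bar>) \<le> a n" using 1 by linarith
      then have "(real n * (a m / real m) - (\<bar>a m\<bar> + \<bar>c\<bar>)) / real n \<le> a n / real n"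
        by (intro divide_right_mono) auto
      moreover have "(real n * (a m / real m) - (\<bar>a m\<bar> + \<bar>c\<bar>)) / real n
          = a m / real m - (\<bar>a m\<bar> + \<bar>c\<bar>) / real n"
        using m n by (simp add: diff_divide_distrib)
      ultimately show ?thesis by simp
    qed
    then show ?thesis by blast
  qed
  have "(\<lambda>n. a n / real n) \<longlonglongrightarrow> L"
  proof (rule order_tendstoI)
    fix y assume "y < L"
    then obtain m where m: "m \<ge> 1" "y < a m / real m"
      using less_cSup_iff[of ?A y] bdd unfolding L_def by auto
    obtain K where K: "\<And>n. n \<ge> m \<Longrightarrow> a m / real m - K / real n \<le> a n / real n"
      using lower[OF m(1)] by blast
    have "(\<lambda>n. a m / real m - K / real n) \<longlonglongrightarrow> a m / real m - 0"
      by (intro tendsto_diff tendsto_const lim_const_over_n)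
    then have "\<forall>\<^sub>F n in sequentially. y < a m / real m - K / real n"
      using m(2) by (intro order_tendstoD(1)) auto
    then show "\<forall>\<^sub>F n in sequentially. y < a n / real n"
      using eventually_ge_at_top[of m] by eventually_elim (use K in force)
  next
    fix y assume "L < y"
    show "\<forall>\<^sub>F n in sequentially. a n / real n < y"
      using eventually_ge_at_top[of "1::nat"] by eventually_elim (use upper \<open>L < y\<close> in force)
  qed
  then show ?thesis by (rule convergentI)
qed

theorem theorem3p1:
  fixes V :: "(real^'n::finite) set"
  assumes "tropical_prevariety V"
    and "prevariety_dim V = 1"
  shows "convergent (\<lambda>k. real (tropical_hilbert V k) / real k)"
proof -
  obtain P where P: "polyhedral_decomposition V P"
    using polyhedral_decomposition_exists[OF assms(1)] by blast
  then have fin: "finite P" "V = \<Union>P" and rat: "\<And>S. S \<in> P \<Longrightarrow> rational_polyhedron S"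
    unfolding polyhedral_decomposition_def by blast+
  have dim: "aff_dim S \<le> 1" if "S \<in> P" for S
    using prevariety_dim_eq[OF P] assms(2) fin(1) that by (metis Max_ge finite_imageI imageI)
  obtain C where C: "\<And>k. tropical_hilbert V k \<le> C * k + card P"
    using tropical_hilbert_linear_bound[OF fin(1) _ fin(2)] rat dim by blast
  \<comment> \<open>Subtracting \<open>card P\<close> absorbs the error term of superadditivity and changes \<open>TH(k)/k\<close> by \<open>O(1/k)\<close>.\<close>
  define a where "a k = real (tropical_hilbert V k) - real (card P)" for k
  have "convergent (\<lambda>k. a k / real k)"
  proof (rule superadditive_convergent)
    show "a m + a n \<le> a (m + n)" for m n
      using tropical_hilbert_superadditive[OF fin(1) _ fin(2), of m n] rat dim
        rational_polyhedron_closed_convex(2)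
      unfolding a_def collinear_aff_dim by force
    show "a n \<le> real C * real n" for n
      using C[of n] unfolding a_def by (simp flip: of_nat_mult of_nat_add)
  qed
  moreover have "convergent (\<lambda>k. real (card P) / real k)"
    by (rule convergentI[OF lim_const_over_n])
  ultimately have "convergent (\<lambda>k. a k / real k + real (card P) / real k)"
    by (rule convergent_add)
  then show ?thesis by (simp add: a_def diff_divide_distrib)
qed

end
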